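(* Let $n=2^sm$ with $2^s\geq 4$ and $m$ odd. If a symmetric vector $(a_0,a_1,\ldots,a_{n-1})\in\mathbb{F}_2^n$ is the corresponding vector of a normal element of $\mathbb{F}_{2^n}$ over $\mathbb{F}_2$, then the following hold (sums of the $a_j$ being taken in $\mathbb{F}_2$): 1) $\sum_{i=0}^{m-1}a_{i2^s}=1$ and $\sum_{i=0}^{m-1}a_{i2^s+2^{s-1}}=0$; 2) $\sum_{1\leq k\leq 2^{s-1}-1,\ k\text{ odd}}\ \sum_{i=0}^{m-1}a_{i2^s+k}=1$; 3) $\gcd\left(\sum_{0\leq k\leq m-1}\left(\sum_{i=0}^{2^s-1}a_{im+k}\right)x^k,\ x^m-1\right)=1$ in $\mathbb{F}_2[x]$.
   Context: An element $\alpha\in\mathbb{F}_{2^n}$ is a normal element of $\mathbb{F}_{2^n}$ over $\mathbb{F}_2$ if $\{\alpha,\alpha^2,\alpha^{2^2},\ldots,\alpha^{2^{n-1}}\}$ is a basis of $\mathbb{F}_{2^n}$ over $\mathbb{F}_2$. The trace function is $\mathrm{Tr}_{2^n|2}(x)=\sum_{i=0}^{n-1}x^{2^i}$. The corresponding vector of $\alpha\in\mathbb{F}_{2^n}$ is $(a_0,\ldots,a_{n-1})\in\mathbb{F}_2^n$ with $a_i=\mathrm{Tr}_{2^n|2}(\alpha\cdot\alpha^{2^i})$ for $0\leq i\leq n-1$. A vector $(a_0,\ldots,a_{n-1})$ is symmetric if $a_i=a_{n-i}$ for all $1\leq i\leq n-1$. *)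

theory Defs
  imports
    "HOL-Library.Z2"
    "HOL-Library.Cardinality"
    "HOL-Computational_Algebra.Computational_Algebra"
    "HOL-Computational_Algebra.Field_as_Ring"
begin

text \<open>
  The field $\mathbb{F}_2$ is the type \<^typ>\<open>bit\<close>. The following instances make the library's
  \<^const>\<open>gcd\<close> available on \<^typ>\<open>bit poly\<close>.
\<close>

instantiation bit ::
  "{unique_euclidean_ring, normalization_euclidean_semiring, normalization_semidom_multiplicative}"
begin

definition normalize_bit :: "bit \<Rightarrow> bit" where [simp]: "normalize_bit = normalize_field"
definition unit_factor_bit :: "bit \<Rightarrow> bit" where [simp]: "unit_factor_bit = unit_factor_field"
definition euclidean_size_bit :: "bit \<Rightarrow> nat" where [simp]: "euclidean_size_bit = euclidean_size_field"
definition division_segment_bit :: "bit \<Rightarrow> bit" where [simp]: "division_segment_bit x = 1"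

instance
  by standard (simp_all add: dvd_field_iff split: if_splits)

end

instantiation bit :: euclidean_ring_gcd
begin

definition gcd_bit :: "bit \<Rightarrow> bit \<Rightarrow> bit" where "gcd_bit = Euclidean_Algorithm.gcd"
definition lcm_bit :: "bit \<Rightarrow> bit \<Rightarrow> bit" where "lcm_bit = Euclidean_Algorithm.lcm"
definition Gcd_bit :: "bit set \<Rightarrow> bit" where "Gcd_bit = Euclidean_Algorithm.Gcd"
definition Lcm_bit :: "bit set \<Rightarrow> bit" where "Lcm_bit = Euclidean_Algorithm.Lcm"

instance
  by standard (simp_all add: gcd_bit_def lcm_bit_def Gcd_bit_def Lcm_bit_def)

end

instance bit :: field_gcd ..

text \<open>
  Throughout, $\mathbb{F}_{2^n}$ is a type of class \<^class>\<open>finite_field\<close> with $2^n$ elements, and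
  $\mathbb{F}_2$ embeds into it by \<^term>\<open>of_bit\<close>. Elements of $\mathbb{F}_2^n$ are functions
  \<^typ>\<open>nat \<Rightarrow> bit\<close> of which only the values at indices below \<open>n\<close> matter.
\<close>

definition scale_bit :: "bit \<Rightarrow> 'a \<Rightarrow> 'a::finite_field" where
  "scale_bit c x = of_bit c * x"

lemma vector_space_scale_bit:
  assumes "CARD('a) = 2 ^ n"
  shows "vector_space (scale_bit :: bit \<Rightarrow> 'a \<Rightarrow> 'a::finite_field)"
proof -
  have "of_nat CARD('a) = (0 :: 'a)"
  proof -
    have "(\<Sum>x\<in>(UNIV :: 'a set). x) = (\<Sum>x\<in>UNIV. x + 1)"
      by (rule sum.reindex_bij_witness[of _ "\<lambda>x. x + 1" "\<lambda>x. x - 1"]) auto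
    then show ?thesis
      by (simp add: sum.distrib)
  qed
  then have "(2 :: 'a) ^ n = 0"
    using assms by simp
  then have "(1 :: 'a) + 1 = 0"
    by simp
  then have "x + x = 0" for x :: 'a
    by (metis distrib_left mult.right_neutral mult_zero_right)
  then show ?thesis
    by unfold_locales (auto simp: scale_bit_def algebra_simps)
qed

definition is_basis :: "'a::finite_field set \<Rightarrow> bool" where
  "is_basis B \<longleftrightarrow> \<not> module.dependent scale_bit B \<and> module.span scale_bit B = UNIV"

definition normal_element :: "nat \<Rightarrow> 'a::finite_field \<Rightarrow> bool" where
  "normal_element n \<alpha> \<longleftrightarrow> is_basis ((\<lambda>i. \<alpha> ^ (2 ^ i)) ` {..<n})"

definition abs_trace :: "nat \<Rightarrow> 'a \<Rightarrow> 'a::finite_field" where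
  "abs_trace n x = (\<Sum>i<n. x ^ (2 ^ i))"

text \<open>The trace lies in the prime field, so the vector exists and is unique on the indices below \<open>n\<close>.\<close>

definition corresponding_vector :: "nat \<Rightarrow> 'a::finite_field \<Rightarrow> (nat \<Rightarrow> bit) \<Rightarrow> bool" where
  "corresponding_vector n \<alpha> a \<longleftrightarrow> (\<forall>i<n. of_bit (a i) = abs_trace n (\<alpha> * \<alpha> ^ (2 ^ i)))"

definition symmetric_vector :: "nat \<Rightarrow> (nat \<Rightarrow> bit) \<Rightarrow> bool" where
  "symmetric_vector n a \<longleftrightarrow> (\<forall>i. 1 \<le> i \<and> i \<le> n - 1 \<longrightarrow> a i = a (n - i))"

end

theory Submission
  imports Defs
begin

text \<open>
  Let \<open>f\<close> be the polynomial with coefficients \<open>a\<close>. If \<open>p\<close> divides \<open>f\<close> and \<open>X ^ n - 1 = p * h\<close>, then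
  \<open>f * h\<close> annihilates \<open>\<alpha>\<close> when \<open>X\<close> acts as Frobenius. As the trace form is nondegenerate, \<open>f\<close>
  acts injectively, so \<open>h\<close> annihilates the normal element \<open>\<alpha>\<close> and \<open>p\<close> is a unit. Hence \<open>f\<close> is
  coprime to \<open>X ^ n - 1\<close>, and so is its reduction modulo \<open>X ^ m - 1\<close> to \<open>X ^ m - 1\<close>.

  By symmetry the sums in 1) collapse to \<open>a 0 = Tr \<alpha> = 1\<close> and \<open>a (n / 2)\<close>. The latter is the trace of
  an element of the subfield of index 2, hence 0. Likewise the sum in 2) is the sum of the \<open>a j\<close>
  with \<open>j\<close> congruent to 1 modulo 4, which is computed in \<open>\<bbbF>\<^sub>1\<^sub>6\<close> via the trace of \<open>\<alpha>\<close> to that field.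
\<close>

section \<open>Characteristic 2 and the absolute trace\<close>

lemma CHAR_eq_2:
  assumes "CARD('a::finite_field) = 2 ^ n"
  shows "CHAR('a) = 2"
proof -
  interpret vector_space "scale_bit :: bit \<Rightarrow> 'a \<Rightarrow> 'a"
    by (rule vector_space_scale_bit[OF assms])
  have "(1::'a) + 1 = 0"
    using scale_left_distrib[of 1 1 1] by (simp add: scale_bit_def)
  then have "of_nat 2 = (0::'a)"
    by simp
  then have "CHAR('a) dvd 2"
    by (simp only: of_nat_eq_0_iff_char_dvd)
  then show ?thesis
    by (simp add: primes_dvd_imp_eq)
qed

lemma add_self_CHAR_2:
  assumes "CHAR('a::comm_ring_1) = 2"
  shows "x + x = (0::'a)"
proof -
  have "of_nat 2 = (0::'a)"
    using assms by (metis of_nat_CHAR)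
  then have "(1 + 1) * x = 0"
    by simp
  then show ?thesis
    by (simp only: distrib_right mult_1)
qed

lemma of_bit_add:
  assumes "CHAR('a::comm_ring_1) = 2"
  shows "of_bit (c + d) = (of_bit c + of_bit d :: 'a)"
  using add_self_CHAR_2[OF assms, of 1] by (cases c; cases d) simp_all

lemma of_bit_sum:
  assumes "CHAR('a::comm_ring_1) = 2"
  shows "of_bit (sum f A) = (\<Sum>x\<in>A. of_bit (f x) :: 'a)"
proof (induction A rule: infinite_finite_induct)
  case (insert x F)
  then show ?case
    by (simp only: sum.insert[OF insert(1,2)] of_bit_add[OF assms])
qed simp_all

lemma power2_add_CHAR_2:
  assumes "CHAR('a::comm_ring_1) = 2"
  shows "(x + y) ^ 2 = x ^ 2 + (y ^ 2 :: 'a)"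
  by (rule freshmans_dream) (simp_all add: assms)

lemma sum_power2_CHAR_2:
  assumes "CHAR('a::comm_ring_1) = 2"
  shows "(sum f A) ^ 2 = (\<Sum>x\<in>A. f x ^ 2 :: 'a)"
  by (rule freshmans_dream_sum) (simp_all add: assms)

lemma sum_lessThan_shift:
  fixes g :: "nat \<Rightarrow> 'a::ab_group_add"
  assumes "g N = g 0"
  shows "(\<Sum>k<N. g (Suc k)) = (\<Sum>k<N. g k)"
  using sum.lessThan_Suc_shift[of g N] sum.lessThan_Suc[of g N] assms by simp

lemma power_2_power_add: "(x ^ 2 ^ i) ^ 2 ^ j = (x ^ 2 ^ (i + j) :: 'a::monoid_mult)"
  by (simp add: power_add flip: power_mult)

lemma power_card_shift:
  assumes "CARD('a::finite_field) = 2 ^ n"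
  shows "x ^ 2 ^ (n + i) = (x ^ 2 ^ i :: 'a)"
  using finite_field_power_card_eq_same[of x] by (simp add: assms flip: power_2_power_add)

lemma abs_trace_power2:
  assumes "CARD('a::finite_field) = 2 ^ n"
  shows "abs_trace n (x ^ 2) = abs_trace n (x :: 'a)"
  using sum_lessThan_shift[of "\<lambda>i. x ^ 2 ^ i" n] power_card_shift[OF assms, of x 0]
  by (simp add: abs_trace_def flip: power_mult)

text \<open>Squaring permutes the summands of the trace cyclically, so the trace is idempotent, and
  a field has no idempotents besides 0 and 1.\<close>

lemma abs_trace_cases:
  assumes "CARD('a::finite_field) = 2 ^ n"
  shows "abs_trace n x \<in> {0, 1 :: 'a}"
proof -
  have "abs_trace n x ^ 2 = abs_trace n (x ^ 2)"
    unfolding abs_trace_def sum_power2_CHAR_2[OF CHAR_eq_2[OF assms]]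
    by (simp add: mult.commute flip: power_mult)
  also have "\<dots> = abs_trace n x"
    by (rule abs_trace_power2[OF assms])
  finally show ?thesis
    by (simp add: power2_eq_square)
qed

text \<open>For nonzero \<open>y\<close> the products \<open>y * x\<close> exhaust the field, so the
  trace polynomial, of degree at most \<open>2 ^ (n - 1)\<close>, would have \<open>2 ^ n\<close>
  roots.\<close>

lemma abs_trace_eq_0_imp:
  fixes y :: "'a::finite_field"
  assumes card: "CARD('a) = 2 ^ n" and "n > 0" and zero: "\<And>x. abs_trace n (y * x) = 0"
  shows "y = 0"
proof (rule ccontr)
  assume "y \<noteq> 0"
  define P :: "'a poly" where "P = (\<Sum>i<n. monom 1 (2 ^ i))"
  have "abs_trace n x = 0" for x :: 'a
    using zero[of "x / y"] \<open>y \<noteq> 0\<close> by simp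
  then have roots: "{x. poly P x = 0} = UNIV"
    by (simp add: P_def abs_trace_def poly_sum poly_monom)
  \<comment> \<open>Only the summand with \<open>i = 0\<close> has exponent 1, so the linear
    coefficient of \<open>P\<close> is 1.\<close>
  have "coeff P 1 = (\<Sum>i<n. if i = 0 then 1 else 0)"
    unfolding P_def coeff_sum by (rule sum.cong) simp_all
  then have "P \<noteq> 0"
    using \<open>n > 0\<close> by auto
  have "degree P \<le> 2 ^ (n - 1)"
    unfolding P_def
  proof (rule degree_sum_le)
    fix i assume "i \<in> {..<n}"
    then have "(2::nat) ^ i \<le> 2 ^ (n - 1)"
      by (intro power_increasing) auto
    then show "degree (monom (1::'a) (2 ^ i)) \<le> 2 ^ (n - 1)"
      using degree_monom_le le_trans by blast
  qed simp
  also have "\<dots> < (2::nat) ^ n"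
    using \<open>n > 0\<close> by (intro power_strict_increasing) auto
  finally show False
    using card_poly_roots_bound[OF \<open>P \<noteq> 0\<close>] roots card by simp
qed

section \<open>Conjugates of a normal element\<close>

text \<open>\<open>normal_element\<close> speaks only of the set of conjugates. Repetitions are
  excluded by counting: every field element is a subset sum of that set, so it has at least
  \<open>n\<close> members.\<close>

lemma normal_element_inj:
  fixes \<alpha> :: "'a::finite_field"
  assumes card: "CARD('a) = 2 ^ n" and normal: "normal_element n \<alpha>"
  shows "inj_on (\<lambda>i. \<alpha> ^ 2 ^ i) {..<n}"
proof -
  interpret vector_space "scale_bit :: bit \<Rightarrow> 'a \<Rightarrow> 'a"
    by (rule vector_space_scale_bit[OF card])
  let ?B = "(\<lambda>i. \<alpha> ^ 2 ^ i) ` {..<n}"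
  have "x \<in> (\<lambda>A. \<Sum>A) ` Pow ?B" for x
  proof -
    have "x \<in> span ?B"
      using normal by (simp add: normal_element_def is_basis_def)
    then obtain u where "x = (\<Sum>v\<in>?B. scale_bit (u v) v)"
      by (auto simp: span_finite)
    also have "\<dots> = (\<Sum>v\<in>?B. if u v = 1 then v else 0)"
      by (intro sum.cong) (auto simp: scale_bit_def)
    also have "\<dots> = \<Sum>{v \<in> ?B. u v = 1}"
      by (simp add: sum.inter_filter)
    finally show ?thesis
      by blast
  qed
  then have "UNIV = (\<lambda>A. \<Sum>A) ` Pow ?B"
    by blast
  then have "CARD('a) \<le> card (Pow ?B)"
    by (metis card_image_le finite_Pow_iff finite_imageI finite_lessThan)
  then have "n \<le> card ?B"
    by (simp add: card card_Pow)
  moreover have "card ?B \<le> n"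
    using card_image_le[of "{..<n}" "\<lambda>i. \<alpha> ^ 2 ^ i"] by simp
  ultimately show ?thesis
    by (simp add: eq_card_imp_inj_on)
qed

text \<open>Injectivity turns independence of the set of conjugates into independence of the family
  indexed by \<open>i < n\<close>.\<close>

lemma normal_element_independent:
  fixes \<alpha> :: "'a::finite_field"
  assumes card: "CARD('a) = 2 ^ n" and normal: "normal_element n \<alpha>"
    and zero: "(\<Sum>i<n. of_bit (c i) * \<alpha> ^ 2 ^ i) = 0" and "i < n"
  shows "c i = 0"
proof -
  interpret vector_space "scale_bit :: bit \<Rightarrow> 'a \<Rightarrow> 'a"
    by (rule vector_space_scale_bit[OF card])
  let ?e = "\<lambda>i. \<alpha> ^ 2 ^ i"
  let ?inv = "the_inv_into {..<n} ?e"
  note inj = normal_element_inj[OF card normal]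
  have "(\<Sum>v\<in>?e ` {..<n}. scale_bit (c (?inv v)) v) = (\<Sum>i<n. of_bit (c i) * ?e i)"
    by (simp add: sum.reindex[OF inj] scale_bit_def the_inv_into_f_f[OF inj])
  then have "c (?inv (?e i)) = 0"
    using independentD[of "?e ` {..<n}" "?e ` {..<n}" "\<lambda>v. c (?inv v)" "?e i"]
      normal zero \<open>i < n\<close> by (simp add: normal_element_def is_basis_def)
  then show ?thesis
    using the_inv_into_f_f[OF inj, of i] \<open>i < n\<close> by simp
qed

text \<open>The \<open>x\<close> with \<open>abs_trace n (y * x) = 0\<close> form a subspace;
  containing a basis, it is the whole field.\<close>

lemma normal_element_nondegenerate:
  fixes \<alpha> y :: "'a::finite_field"
  assumes card: "CARD('a) = 2 ^ n" and "n > 0" and normal: "normal_element n \<alpha>"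
    and zero: "\<And>j. j < n \<Longrightarrow> abs_trace n (y * \<alpha> ^ 2 ^ j) = 0"
  shows "y = 0"
proof (rule abs_trace_eq_0_imp[OF card \<open>n > 0\<close>])
  interpret vector_space "scale_bit :: bit \<Rightarrow> 'a \<Rightarrow> 'a"
    by (rule vector_space_scale_bit[OF card])
  fix x
  note char = CHAR_eq_2[OF card]
  have add: "abs_trace n (u + v) = abs_trace n u + abs_trace n (v :: 'a)" for u v
    using freshmans_dream'[where ?'a = 'a] char by (simp add: abs_trace_def sum.distrib)
  have "subspace {x. abs_trace n (y * x) = 0}"
  proof (rule subspaceI)
    fix c :: bit and x assume "x \<in> {x. abs_trace n (y * x) = 0}"
    then show "scale_bit c x \<in> {x. abs_trace n (y * x) = 0}"
      by (cases c) (simp_all add: scale_bit_def abs_trace_def zero_power)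
  qed (simp_all add: distrib_left add, simp add: abs_trace_def power_0_left)
  then have "span ((\<lambda>i. \<alpha> ^ 2 ^ i) ` {..<n}) \<subseteq> {x. abs_trace n (y * x) = 0}"
    by (intro span_minimal) (auto simp: zero)
  then show "abs_trace n (y * x) = 0"
    using normal by (auto simp: normal_element_def is_basis_def)
qed

section \<open>Polynomials over the prime field acting through Frobenius\<close>

text \<open>
  \<open>frob_poly p x\<close> is the action of \<open>p \<in> \<bbbF>\<^sub>2[X]\<close> with \<open>X\<close> acting as the Frobenius map \<open>x \<mapsto> x\<^sup>2\<close>,
  evaluated in Horner form.
\<close>

definition frob_poly :: "bit poly \<Rightarrow> 'a \<Rightarrow> 'a::comm_ring_1" where
  "frob_poly p x = fold_coeffs (\<lambda>c y. of_bit c * x + y ^ 2) p 0"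

lemma frob_poly_0 [simp]: "frob_poly 0 x = 0"
  by (simp add: frob_poly_def)

lemma frob_poly_pCons [simp]: "frob_poly (pCons c p) x = of_bit c * x + frob_poly p x ^ 2"
  by (cases "p = 0 \<and> c = 0") (auto simp: frob_poly_def)

lemma frob_poly_zero_right [simp]: "frob_poly p 0 = 0"
  by (induction p) simp_all

lemma frob_poly_add:
  assumes "CHAR('a::comm_ring_1) = 2"
  shows "frob_poly (p + q) x = frob_poly p x + (frob_poly q x :: 'a)"
  by (induction p q rule: poly_induct2)
     (simp_all only: add_pCons frob_poly_pCons of_bit_add[OF assms] power2_add_CHAR_2[OF assms],
      simp_all add: algebra_simps)

lemma frob_poly_sum:
  assumes "CHAR('a::comm_ring_1) = 2"
  shows "frob_poly (sum f A) x = (\<Sum>i\<in>A. frob_poly (f i) x :: 'a)"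
  by (induction A rule: infinite_finite_induct) (simp_all add: frob_poly_add[OF assms])

lemma frob_poly_smult: "frob_poly (smult c p) x = of_bit c * frob_poly p x"
  by (cases c) simp_all

text \<open>Products act as compositions, so commutativity of \<open>bit poly\<close> lets factors
  be applied in any order.\<close>

lemma frob_poly_mult:
  assumes "CHAR('a::comm_ring_1) = 2"
  shows "frob_poly (p * q) x = (frob_poly p (frob_poly q x) :: 'a)"
  by (induction p) (simp_all add: frob_poly_add[OF assms] frob_poly_smult)

lemma frob_poly_monom: "frob_poly (monom c k) x = of_bit c * x ^ 2 ^ k"
  by (induction k) (cases c; simp add: monom_0 monom_Suc mult.commute flip: power_mult)+

lemma frob_poly_altdef:
  assumes "CHAR('a::comm_ring_1) = 2" and "degree p < n"
  shows "frob_poly p x = (\<Sum>i<n. of_bit (coeff p i) * x ^ 2 ^ i :: 'a)"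
proof -
  have "p = (\<Sum>i<n. monom (coeff p i) i)"
    using assms(2) by (intro poly_eqI) (auto simp: coeff_sum coeff_eq_0)
  then have "frob_poly p x = frob_poly (\<Sum>i<n. monom (coeff p i) i) x"
    by (rule arg_cong)
  then show ?thesis
    by (simp only: frob_poly_sum[OF assms(1)] frob_poly_monom)
qed

text \<open>
  Expanding the traces in the action of the vector of \<open>\<alpha>\<close> on \<open>y\<close> gives
  \<open>\<Sum>j. Tr (y * \<alpha> ^ 2 ^ j) * \<alpha> ^ 2 ^ j\<close>, so this action is injective.
\<close>

lemma frob_poly_corresponding_vector_eq_0:
  fixes \<alpha> y :: "'a::finite_field"
  assumes card: "CARD('a) = 2 ^ n" and "n > 0" and normal: "normal_element n \<alpha>"
    and vec: "corresponding_vector n \<alpha> a"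
    and zero: "frob_poly (\<Sum>i<n. monom (a i) i) y = 0"
  shows "y = 0"
proof -
  \<comment> \<open>Reading the traces as bits makes the final sum a combination of conjugates over
    the prime field.\<close>
  define c :: "nat \<Rightarrow> bit"
    where "c = (\<lambda>j. if abs_trace n (y * \<alpha> ^ 2 ^ j) = 0 then 0 else 1)"
  have c: "abs_trace n (y * \<alpha> ^ 2 ^ j) = of_bit (c j)" for j
    using abs_trace_cases[OF card, of "y * \<alpha> ^ 2 ^ j"] by (auto simp: c_def)
  have vec': "of_bit (a i) = (\<Sum>j<n. \<alpha> ^ 2 ^ j * \<alpha> ^ 2 ^ (i + j))" if "i < n" for i
    using vec that
    unfolding corresponding_vector_def abs_trace_def power_mult_distrib power_2_power_add by blast
  have "0 = (\<Sum>i<n. of_bit (a i) * y ^ 2 ^ i)"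
    using zero by (simp only: frob_poly_sum[OF CHAR_eq_2[OF card]] frob_poly_monom)
  also have "\<dots> = (\<Sum>i<n. \<Sum>j<n. (\<alpha> ^ 2 ^ j * \<alpha> ^ 2 ^ (i + j)) * y ^ 2 ^ i)"
    by (intro sum.cong refl) (simp only: vec' lessThan_iff sum_distrib_right)
  \<comment> \<open>With \<open>j\<close> fixed, the sum over \<open>i\<close> of
    \<open>\<alpha> ^ 2 ^ (i + j) * y ^ 2 ^ i\<close> is the trace of
    \<open>y * \<alpha> ^ 2 ^ j\<close>.\<close>
  also have "\<dots> = (\<Sum>j<n. \<Sum>i<n. (\<alpha> ^ 2 ^ j * \<alpha> ^ 2 ^ (i + j)) * y ^ 2 ^ i)"
    by (rule sum.swap)
  also have "\<dots> = (\<Sum>j<n. of_bit (c j) * \<alpha> ^ 2 ^ j)"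
    unfolding c[symmetric] abs_trace_def power_mult_distrib power_2_power_add sum_distrib_right
    by (simp only: mult_ac add.commute)
  finally have c_0: "c j = 0" if "j < n" for j
    using normal_element_independent[OF card normal _ that, of c] by simp
  show ?thesis
    by (rule normal_element_nondegenerate[OF card \<open>n > 0\<close> normal]) (simp add: c c_0)
qed

lemma coprime_corresponding_vector:
  fixes \<alpha> :: "'a::finite_field"
  assumes card: "CARD('a) = 2 ^ n" and "n > 0" and normal: "normal_element n \<alpha>"
    and vec: "corresponding_vector n \<alpha> a"
  shows "coprime (\<Sum>i<n. monom (a i) i) (monom 1 n - 1)"
proof (rule coprimeI)
  note char = CHAR_eq_2[OF card]
  fix p :: "bit poly"
  let ?f = "\<Sum>i<n. monom (a i) i"
  assume "p dvd ?f" and "p dvd monom 1 n - 1"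
  then obtain q h where q: "?f = p * q" and h: "monom 1 n - 1 = p * h"
    by (auto elim!: dvdE)
  \<comment> \<open>Subtraction becomes addition, to which \<open>frob_poly_add\<close>
    applies.\<close>
  have X: "monom 1 n - 1 = monom 1 n + (monom 1 0 :: bit poly)"
    by (rule poly_eqI) simp
  have deg: "degree (monom 1 n - 1 :: bit poly) = n"
    using \<open>n > 0\<close> by (simp add: degree_monom_eq X degree_add_eq_left)
  have nz: "p \<noteq> 0" "h \<noteq> 0"
    using h deg \<open>n > 0\<close> by auto
  have "frob_poly (monom 1 n - 1) \<alpha> = 0"
    unfolding X frob_poly_add[OF char] frob_poly_monom
    using power_card_shift[OF card, of \<alpha> 0] add_self_CHAR_2[OF char, of \<alpha>] by simp
  then have "frob_poly (q * (p * h)) \<alpha> = 0"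
    by (simp add: frob_poly_mult[OF char, of q] flip: h)
  then have "frob_poly ?f (frob_poly h \<alpha>) = 0"
    by (simp add: q mult_ac flip: frob_poly_mult[OF char])
  then have zero: "frob_poly h \<alpha> = 0"
    by (rule frob_poly_corresponding_vector_eq_0[OF card \<open>n > 0\<close> normal vec])
  \<comment> \<open>Otherwise the coefficients of \<open>h\<close> give a vanishing combination of
    the conjugates, forcing \<open>h = 0\<close>.\<close>
  have "\<not> degree h < n"
  proof
    assume less: "degree h < n"
    have "coeff h i = 0" if "i < n" for i
      using normal_element_independent[OF card normal _ that, of "coeff h"] zero
      by (simp add: frob_poly_altdef[OF char less])
    then show False
      using nz less leading_coeff_0_iff by blast
  qed
  moreover have "degree p + degree h = n"
    using nz deg by (simp add: h degree_mult_eq)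
  ultimately show "is_unit p"
    using nz by (simp add: is_unit_iff_degree)
qed

section \<open>Entries of the corresponding vector and their sums\<close>

text \<open>The entry is the trace of \<open>\<alpha> ^ 2\<close>, hence that of
  \<open>\<alpha>\<close>. Were it 0, the conjugates would be dependent with all coefficients
  1.\<close>

lemma corresponding_vector_0:
  fixes \<alpha> :: "'a::finite_field"
  assumes card: "CARD('a) = 2 ^ n" and "n > 0" and normal: "normal_element n \<alpha>"
    and vec: "corresponding_vector n \<alpha> a"
  shows "a 0 = 1" and "abs_trace n \<alpha> = 1"
proof -
  have "of_bit (a 0) = abs_trace n (\<alpha> ^ 2)"
    using vec \<open>n > 0\<close> by (simp add: corresponding_vector_def power2_eq_square)
  then have a0: "of_bit (a 0) = abs_trace n \<alpha>"
    by (simp add: abs_trace_power2[OF card])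
  have "abs_trace n \<alpha> \<noteq> 0"
    using normal_element_independent[OF card normal _ \<open>n > 0\<close>, of "\<lambda>_. 1"]
    by (auto simp: abs_trace_def)
  with a0 show "a 0 = 1" "abs_trace n \<alpha> = 1"
    by (auto split: if_splits simp: of_bool_def)
qed

text \<open>The summands of this trace have period \<open>l\<close>, so its two halves
  cancel.\<close>

lemma corresponding_vector_half:
  fixes \<alpha> :: "'a::finite_field"
  assumes card: "CARD('a) = 2 ^ (2 * l)" and "l > 0"
    and vec: "corresponding_vector (2 * l) \<alpha> a"
  shows "a l = 0"
proof -
  note char = CHAR_eq_2[OF card]
  let ?g = "\<lambda>i. \<alpha> ^ 2 ^ i * \<alpha> ^ 2 ^ (l + i)"
  have shift: "\<alpha> ^ 2 ^ (l + (l + i)) = \<alpha> ^ 2 ^ i" for i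
    using power_card_shift[OF card, of \<alpha> i] by (simp only: mult_2 add.assoc)
  have "of_bit (a l) = (\<Sum>i<l + l. ?g i)"
    using vec \<open>l > 0\<close>
    by (simp add: corresponding_vector_def abs_trace_def power_mult_distrib power_2_power_add
        mult_2)
  also have "\<dots> = (\<Sum>i<l. ?g i) + (\<Sum>i<l. ?g (l + i))"
    unfolding lessThan_atLeast0 sum.atLeastLessThan_concat[of 0 l "l + l" ?g, symmetric, simplified]
    using sum.shift_bounds_nat_ivl[of ?g 0 l l] by (simp only: add_0 add.commute)
  also have "(\<Sum>i<l. ?g (l + i)) = (\<Sum>i<l. ?g i)"
    by (simp only: shift mult.commute)
  finally show ?thesis
    by (simp add: add_self_CHAR_2[OF char] split: if_splits)
qed

lemma sum_lessThan_times_4: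
  fixes g :: "nat \<Rightarrow> 'a::comm_monoid_add"
  shows "(\<Sum>i<4 * N. g i) = (\<Sum>q<N. g (4 * q) + g (4 * q + 1) + g (4 * q + 2) + g (4 * q + 3))"
proof (induction N)
  case (Suc N)
  have "4 * Suc N = Suc (Suc (Suc (Suc (4 * N))))"
    by simp
  then show ?case
    using Suc by (simp only: sum.lessThan_Suc) (simp add: add_ac numeral_3_eq_3)
qed simp

text \<open>
  The sums \<open>\<gamma> r\<close> of every fourth conjugate are the conjugates of the trace of \<open>\<alpha>\<close> to the
  subfield \<open>\<bbbF>\<^sub>1\<^sub>6\<close>. There \<open>u = \<gamma> 0 + \<gamma> 2\<close> satisfies \<open>u + u\<^sup>2 = 1\<close>, whence \<open>u * u\<^sup>2 = 1\<close>.
\<close>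

lemma corresponding_vector_sum_1_mod_4:
  fixes \<alpha> :: "'a::finite_field"
  assumes card: "CARD('a) = 2 ^ (4 * N)" and "N > 0" and normal: "normal_element (4 * N) \<alpha>"
    and vec: "corresponding_vector (4 * N) \<alpha> a"
  shows "(\<Sum>k<N. a (4 * k + 1)) = 1"
proof -
  note char = CHAR_eq_2[OF card]
  define e where "e = (\<lambda>i. \<alpha> ^ 2 ^ i)"
  define \<gamma> where "\<gamma> = (\<lambda>r. \<Sum>k<N. e (4 * k + r))"
  have e_period: "e (4 * N + r) = e r" for r
    by (simp only: e_def power_card_shift[OF card])
  have \<gamma>_4: "\<gamma> (r + 4) = \<gamma> r" for r
    using sum_lessThan_shift[of "\<lambda>k. e (4 * k + r)" N] e_period[of r]
    by (simp add: \<gamma>_def add_ac)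
  have \<gamma>_period: "\<gamma> (4 * q + r) = \<gamma> r" for q r
  proof (induction q)
    case (Suc q)
    then show ?case
      using \<gamma>_4[of "4 * q + r"] by (simp add: add_ac)
  qed simp
  have succ: "4 * q + 1 + 1 = 4 * q + 2" "4 * q + 2 + 1 = 4 * q + 3" "4 * q + 3 + 1 = 4 * q + 4"
    for q :: nat
    by simp_all
  have \<gamma>_power2: "\<gamma> r ^ 2 = \<gamma> (r + 1)" for r
    unfolding \<gamma>_def sum_power2_CHAR_2[OF char] e_def
    by (simp add: mult.commute flip: power_mult)
  define u where "u = \<gamma> 0 + \<gamma> 2"
  have u2: "u ^ 2 = \<gamma> 1 + \<gamma> 3"
    by (simp add: u_def power2_add_CHAR_2[OF char] \<gamma>_power2)
  \<comment> \<open>The four sums \<open>\<gamma> r\<close> together run over all conjugates and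
    give the trace of \<open>\<alpha>\<close>.\<close>
  have "u + u ^ 2 = (\<Sum>i<4 * N. e i)"
    unfolding u2 unfolding u_def sum_lessThan_times_4 by (simp add: \<gamma>_def sum.distrib add_ac)
  also have "\<dots> = 1"
    using corresponding_vector_0(2)[OF card _ normal vec] \<open>N > 0\<close>
    by (simp add: abs_trace_def e_def)
  finally have u_eq: "u + u ^ 2 = 1" .
  have "u * u = u + 1"
    using u_eq add_self_CHAR_2[OF char, of u]
    by (metis add.assoc add.right_neutral add.commute power2_eq_square)
  then have "u * u ^ 2 = 1"
    using u_eq by (metis distrib_left mult.right_neutral power2_eq_square add.commute)
  have "of_bit (\<Sum>k<N. a (4 * k + 1)) = (\<Sum>k<N. \<Sum>i<4 * N. e i * e (i + (4 * k + 1)))"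
    unfolding of_bit_sum[OF char]
  proof (intro sum.cong refl)
    fix k assume "k \<in> {..<N}"
    then have "4 * k + 1 < 4 * N"
      by simp
    then have "of_bit (a (4 * k + 1)) = abs_trace (4 * N) (\<alpha> * \<alpha> ^ 2 ^ (4 * k + 1))"
      using vec unfolding corresponding_vector_def by blast
    also have "\<dots> = (\<Sum>i<4 * N. e i * e (i + (4 * k + 1)))"
      unfolding abs_trace_def e_def power_mult_distrib power_2_power_add
      by (simp only: add.commute)
    finally show "of_bit (a (4 * k + 1)) = (\<Sum>i<4 * N. e i * e (i + (4 * k + 1)))" .
  qed
  also have "\<dots> = (\<Sum>i<4 * N. \<Sum>k<N. e i * e (i + (4 * k + 1)))"
    by (rule sum.swap)
  also have "\<dots> = (\<Sum>i<4 * N. e i * \<gamma> (i + 1))"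
    by (simp add: \<gamma>_def sum_distrib_left add_ac)
  \<comment> \<open>\<open>\<gamma>\<close> depends only on the index modulo 4, so \<open>i\<close>
    is split by residue.\<close>
  also have "\<dots> = (\<Sum>q<N. e (4 * q) * \<gamma> 1 + e (4 * q + 1) * \<gamma> 2 + e (4 * q + 2) * \<gamma> 3
      + e (4 * q + 3) * \<gamma> 0)"
    by (simp only: sum_lessThan_times_4 succ \<gamma>_period \<gamma>_4[of 0, simplified])
  also have "\<dots> = \<gamma> 0 * \<gamma> 1 + \<gamma> 1 * \<gamma> 2 + \<gamma> 2 * \<gamma> 3 + \<gamma> 3 * \<gamma> 0"
    by (simp add: \<gamma>_def sum.distrib sum_distrib_right)
  \<comment> \<open>The cyclic sum of products factors as
    \<open>(\<gamma> 0 + \<gamma> 2) * (\<gamma> 1 + \<gamma> 3)\<close>.\<close>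
  also have "\<dots> = u * u ^ 2"
    unfolding u2 unfolding u_def by (simp add: algebra_simps)
  finally show ?thesis
    using \<open>u * u ^ 2 = 1\<close> by (auto split: if_splits simp: of_bool_def)
qed

section \<open>Index sums of symmetric vectors\<close>

text \<open>Points moved by \<open>g\<close> pair off with equal values and cancel modulo 2; the
  order on \<open>nat\<close> picks one point of each pair.\<close>

lemma sum_bit_involution:
  fixes f :: "nat \<Rightarrow> bit"
  assumes "finite A" and "\<And>x. x \<in> A \<Longrightarrow> g x \<in> A" and "\<And>x. x \<in> A \<Longrightarrow> g (g x) = x"
    and "\<And>x. x \<in> A \<Longrightarrow> f (g x) = f x"
  shows "sum f A = sum f {x \<in> A. g x = x}"
proof -
  have "A = {x \<in> A. g x = x} \<union> ({x \<in> A. g x < x} \<union> {x \<in> A. x < g x})"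
    by auto
  then have "sum f A = sum f ({x \<in> A. g x = x} \<union> ({x \<in> A. g x < x} \<union> {x \<in> A. x < g x}))"
    by simp
  also have "\<dots> = sum f {x \<in> A. g x = x} + (sum f {x \<in> A. g x < x} + sum f {x \<in> A. x < g x})"
    using \<open>finite A\<close> by (subst sum.union_disjoint; (subst sum.union_disjoint)?) auto
  also have "sum f {x \<in> A. g x < x} = sum f {x \<in> A. x < g x}"
    by (rule sum.reindex_bij_witness[of _ g g]) (auto simp: assms)
  finally show ?thesis
    by (cases "sum f {x \<in> A. x < g x}") simp_all
qed

lemma symmetric_vector_sum_residue_0:
  assumes "symmetric_vector (d * m) a" and "d > 0" and "odd m"
  shows "(\<Sum>i<m. a (i * d)) = a 0"
proof -
  \<comment> \<open>The index 0 is fixed separately, since \<open>m - 0\<close> leaves the range; as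
    \<open>m\<close> is odd, \<open>m - i\<close> fixes no other index.\<close>
  have "(\<Sum>i<m. a (i * d)) = (\<Sum>i | i \<in> {..<m} \<and> (if i = 0 then 0 else m - i) = i. a (i * d))"
  proof (rule sum_bit_involution)
    fix i assume i: "i \<in> {..<m}"
    show "a ((if i = 0 then 0 else m - i) * d) = a (i * d)"
    proof (cases "i = 0")
      case False
      then have "1 \<le> i * d" "i * d < d * m"
        using i \<open>d > 0\<close> by (simp_all add: mult.commute Suc_le_eq)
      then have "1 \<le> i * d \<and> i * d \<le> d * m - 1"
        by linarith
      then have "a (i * d) = a (d * m - i * d)"
        using assms(1) unfolding symmetric_vector_def by blast
      moreover have "(m - i) * d = d * m - i * d"
        by (simp add: diff_mult_distrib mult.commute[of d])
      ultimately show ?thesis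
        using False by simp
    qed simp
  qed auto
  also have "{i. i \<in> {..<m} \<and> (if i = 0 then 0 else m - i) = i} = {0}"
  proof -
    have "m - i \<noteq> i" if "i < m" for i
      using \<open>odd m\<close> that by presburger
    then show ?thesis
      using odd_pos[OF \<open>odd m\<close>] by auto
  qed
  finally show ?thesis
    by simp
qed

lemma symmetric_vector_sum_residue_half:
  assumes "symmetric_vector (2 * d * m) a" and "d > 0" and "odd m"
  shows "(\<Sum>i<m. a (i * (2 * d) + d)) = a (d * m)"
proof -
  have "(\<Sum>i<m. a (i * (2 * d) + d)) = (\<Sum>i | i \<in> {..<m} \<and> m - 1 - i = i. a (i * (2 * d) + d))"
  proof (rule sum_bit_involution)
    fix i assume i: "i \<in> {..<m}"
    then obtain k where k: "m = i + k + 1"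
      by (auto simp: less_iff_Suc_add)
    have "1 \<le> i * (2 * d) + d" "i * (2 * d) + d < 2 * d * m"
      using \<open>d > 0\<close> by (simp_all add: k algebra_simps)
    then have "a (i * (2 * d) + d) = a (2 * d * m - (i * (2 * d) + d))"
      using assms(1) by (simp add: symmetric_vector_def)
    also have "2 * d * m - (i * (2 * d) + d) = (m - 1 - i) * (2 * d) + d"
      by (simp add: k algebra_simps)
    finally show "a ((m - 1 - i) * (2 * d) + d) = a (i * (2 * d) + d)"
      by simp
  qed auto
  \<comment> \<open>The middle index \<open>i = m div 2\<close> gives the position
    \<open>d * m\<close>, half the length.\<close>
  also have "{i. i \<in> {..<m} \<and> m - 1 - i = i} = {m div 2}"
    using \<open>odd m\<close> by (auto elim!: oddE)
  also have "(\<Sum>i\<in>{m div 2}. a (i * (2 * d) + d)) = a (d * m)"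
    using \<open>odd m\<close> by (auto elim!: oddE simp: algebra_simps)
  finally show ?thesis .
qed

text \<open>
  Of the two indices \<open>j\<close> and \<open>n - j\<close> with \<open>j\<close> odd, exactly one is \<open>1\<close> modulo \<open>4\<close>, and exactly one
  has its residue modulo \<open>4 * d\<close> in the lower half.
\<close>

lemma symmetric_vector_sum_odd_residues:
  assumes sym: "symmetric_vector (4 * d * m) a" and "d > 0"
  shows "(\<Sum>k | 1 \<le> k \<and> k \<le> 2 * d - 1 \<and> odd k. \<Sum>i<m. a (i * (4 * d) + k))
    = (\<Sum>k<d * m. a (4 * k + 1))"
proof -
  let ?n = "4 * d * m"
  let ?L = "{j. j < ?n \<and> odd j \<and> j mod (4 * d) < 2 * d}"
  \<comment> \<open>Since \<open>4 * d\<close> divides the length, reflection negates residues;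
    oddness of \<open>j\<close> keeps the residue nonzero.\<close>
  have modn: "(?n - j) mod (4 * d) = 4 * d - j mod (4 * d)" if "j < ?n" "odd j" for j
  proof -
    have "j mod (4 * d) < 4 * d"
      using \<open>d > 0\<close> by simp
    have "j mod (4 * d) > 0"
      using that(2) odd_pos[of "j mod (4 * d)"] by (simp add: dvd_mod_iff)
    have "j div (4 * d) < m"
      using that(1) by (simp add: less_mult_imp_div_less mult.commute)
    then obtain k where k: "m = j div (4 * d) + k + 1"
      by (auto simp: less_iff_Suc_add)
    have "?n = 4 * d * (j div (4 * d)) + 4 * d * k + 4 * d"
      by (subst k) (simp only: distrib_left mult_1_right)
    then have "?n - j = (4 * d - j mod (4 * d)) + 4 * d * k"
      using mult_div_mod_eq[of "4 * d" j] \<open>j mod (4 * d) < 4 * d\<close> by linarith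
    moreover have "4 * d - j mod (4 * d) < 4 * d"
      using \<open>j mod (4 * d) > 0\<close> \<open>d > 0\<close> by linarith
    ultimately show ?thesis
      by (simp only: mod_mult_self2 mod_less)
  qed
  have reflect: "?n - j < ?n \<and> odd (?n - j) \<and> ?n - (?n - j) = j \<and> a (?n - j) = a j"
    if "j < ?n" "odd j" for j
  proof -
    have "1 \<le> j \<and> j \<le> ?n - 1"
      using that odd_pos[OF that(2)] by linarith
    then have "a (?n - j) = a j"
      using sym unfolding symmetric_vector_def by metis
    then show ?thesis
      using that odd_pos[OF that(2)] by auto
  qed
  have lower_half: "(?n - j) mod (4 * d) < 2 * d \<longleftrightarrow> \<not> j mod (4 * d) < 2 * d"
    if "j < ?n" "odd j" for j
  proof -
    have "odd (j mod (4 * d))"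
      using that by (simp add: odd_iff_mod_2_eq_one mod_mod_cancel)
    \<comment> \<open>The midpoint \<open>2 * d\<close> is even, so negation swaps the two halves
      without exception.\<close>
    then have "j mod (4 * d) \<noteq> 2 * d"
      by auto
    then show ?thesis
      unfolding modn[OF that] using \<open>d > 0\<close> by linarith
  qed
  have mod_4: "(?n - j) mod 4 = 1 \<longleftrightarrow> j mod 4 \<noteq> 1" if "j < ?n" "odd j" for j
  proof -
    have "j div 4 < d * m"
      using that by (intro less_mult_imp_div_less) (simp add: mult_ac)
    then obtain p where "d * m = j div 4 + p + 1"
      by (auto simp: less_iff_Suc_add)
    then have "?n = 4 * (j div 4) + 4 * p + 4"
      by (simp add: mult.assoc)
    moreover have "j mod 4 < 4"
      by simp
    ultimately have "?n - j = (4 - j mod 4) + 4 * p"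
      using mult_div_mod_eq[of 4 j] by linarith
    moreover have "j mod 4 = 1 \<or> j mod 4 = 3"
      using \<open>odd j\<close> by presburger
    ultimately show ?thesis
      by auto
  qed
  have odd_mod_4: "odd j" if "j mod 4 = 1" for j :: nat
    using that by presburger
  have "(\<Sum>k | 1 \<le> k \<and> k \<le> 2 * d - 1 \<and> odd k. \<Sum>i<m. a (i * (4 * d) + k))
    = (\<Sum>(k, i)\<in>{k. 1 \<le> k \<and> k \<le> 2 * d - 1 \<and> odd k} \<times> {..<m}. a (i * (4 * d) + k))"
    by (rule sum.cartesian_product)
  \<comment> \<open>Division with remainder by \<open>4 * d\<close> matches the pairs
    \<open>(k, i)\<close> with the indices in \<open>?L\<close>.\<close>
  also have "\<dots> = (\<Sum>j\<in>?L. a j)"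
  proof (rule sum.reindex_bij_witness[of _ "\<lambda>j. (j mod (4 * d), j div (4 * d))"
        "\<lambda>(k, i). i * (4 * d) + k"], goal_cases)
    case (1 x)
    then show ?case
      using \<open>d > 0\<close> by auto
  next
    case (2 x)
    then obtain k i where x: "x = (k, i)" "1 \<le> k" "k < 2 * d" "odd k" "i < m"
      using \<open>d > 0\<close> by (cases x) auto
    obtain r where "m = i + r + 1"
      using x by (auto simp: less_iff_Suc_add)
    then have "i * (4 * d) + k < ?n"
      using x by (simp add: algebra_simps)
    then show ?case
      using x by simp
  next
    case (3 j)
    then show ?case
      by (simp add: mult.commute)
  next
    case (4 j)
    then have "j div (4 * d) < m"
      by (intro less_mult_imp_div_less) (simp add: mult.commute)
    moreover have odd: "odd (j mod (4 * d))"
      using 4 by (simp add: dvd_mod_iff)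
    moreover have "1 \<le> j mod (4 * d)"
      using odd_pos[OF odd] by simp
    moreover have "j mod (4 * d) \<le> 2 * d - 1"
      using 4 by (elim CollectE conjE) linarith
    ultimately show ?case
      by simp
  next
    case (5 x)
    then show ?case
      by (cases x) simp
  qed
  \<comment> \<open>Both index sets choose one member from each pair \<open>j\<close>,
    \<open>?n - j\<close>, and \<open>a\<close> agrees on the pair.\<close>
  also have "\<dots> = (\<Sum>j | j < ?n \<and> j mod 4 = 1. a j)"
  proof (rule sum.reindex_bij_witness[of _ "\<lambda>j. if j mod (4 * d) < 2 * d then j else ?n - j"
        "\<lambda>j. if j mod 4 = 1 then j else ?n - j"])
  qed (use reflect lower_half mod_4 odd_mod_4 in auto)
  also have "\<dots> = (\<Sum>k<d * m. a (4 * k + 1))"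
  proof (rule sum.reindex_bij_witness[of _ "\<lambda>k. 4 * k + 1" "\<lambda>j. j div 4"])
    fix j assume "j \<in> {j. j < ?n \<and> j mod 4 = 1}"
    then show "4 * (j div 4) + 1 = j" and "a (4 * (j div 4) + 1) = a j"
      using mult_div_mod_eq[of 4 j] by simp_all
  qed auto
  finally show ?thesis .
qed

section \<open>Reduction modulo \<open>monom 1 m - 1\<close>, and the conclusion\<close>

lemma monom_diff_1_dvd: "monom 1 m - 1 dvd (monom 1 (k * m) - 1 :: 'a::comm_ring_1 poly)"
proof -
  have "monom 1 (k * m) = (monom 1 m ^ k :: 'a poly)"
    by (simp add: monom_power mult.commute)
  then show ?thesis
    by (metis dvd_triv_left power_diff_1_eq)
qed

text \<open>Folding exponents modulo \<open>m\<close> changes the polynomial by a multiple of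
  \<open>monom 1 m - 1\<close>, so it creates no new common divisors with
  \<open>monom 1 m - 1\<close>.\<close>

lemma coprime_fold_monom:
  fixes a :: "nat \<Rightarrow> 'a::field_gcd"
  assumes "coprime (\<Sum>j<l * m. monom (a j) j) (monom 1 (l * m) - 1)"
  shows "coprime (\<Sum>k<m. monom (\<Sum>i<l. a (i * m + k)) k) (monom 1 m - 1)"
proof -
  let ?X = "monom 1 m - 1 :: 'a poly"
  let ?F = "\<Sum>k<m. monom (\<Sum>i<l. a (i * m + k)) k"
  have block: "sum g {c..<c + m} = (\<Sum>k<m. g (c + k))" for g :: "nat \<Rightarrow> 'a poly" and c
    using sum.shift_bounds_nat_ivl[of g 0 c m] by (simp add: lessThan_atLeast0 add.commute)
  have "(\<Sum>j<l * m. monom (a j) j) = (\<Sum>i<l. \<Sum>j\<in>{i * m..<i * m + m}. monom (a j) j)"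
    by (simp add: sum.nat_group)
  also have "\<dots> = (\<Sum>i<l. \<Sum>k<m. monom (a (i * m + k)) (i * m + k))"
    by (simp only: block)
  \<comment> \<open>Each monomial of exponent \<open>i * m + k\<close> is the one of exponent
    \<open>k\<close> plus its multiple by \<open>monom 1 (i * m) - 1\<close>.\<close>
  also have "\<dots> = (\<Sum>i<l. \<Sum>k<m. monom (a (i * m + k)) k)
      + (\<Sum>i<l. \<Sum>k<m. monom (a (i * m + k)) k * (monom 1 (i * m) - 1))"
    by (simp add: algebra_simps mult_monom flip: sum.distrib)
  also have "(\<Sum>i<l. \<Sum>k<m. monom (a (i * m + k)) k) = ?F"
    by (subst sum.swap) (simp add: monom_sum)
  finally have eq: "(\<Sum>j<l * m. monom (a j) j)
    = ?F + (\<Sum>i<l. \<Sum>k<m. monom (a (i * m + k)) k * (monom 1 (i * m) - 1))" .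
  have "?X dvd (\<Sum>i<l. \<Sum>k<m. monom (a (i * m + k)) k * (monom 1 (i * m) - 1))"
    by (intro dvd_sum dvd_mult monom_diff_1_dvd)
  then have *: "c dvd (\<Sum>j<l * m. monom (a j) j)" if "c dvd ?F" "c dvd ?X" for c
    unfolding eq using that by (meson dvd_add dvd_trans)
  have "coprime (\<Sum>j<l * m. monom (a j) j) ?X"
    by (rule coprime_divisors[OF dvd_refl monom_diff_1_dvd assms])
  then show ?thesis
    using * by (intro coprimeI) (rule coprime_common_divisor)
qed

theorem proposition5p2:
  fixes n s m :: nat and a :: "nat \<Rightarrow> bit" and \<alpha> :: "'a::finite_field"
  assumes "n = 2 ^ s * m" and "(2::nat) ^ s \<ge> 4" and "odd m"
    and "CARD('a) = 2 ^ n"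
    and "symmetric_vector n a"
    and "normal_element n \<alpha>"
    and "corresponding_vector n \<alpha> a"
  shows "((\<Sum>i<m. a (i * 2 ^ s)) = 1 \<and> (\<Sum>i<m. a (i * 2 ^ s + 2 ^ (s - 1))) = 0)
    \<and> (\<Sum>k | 1 \<le> k \<and> k \<le> 2 ^ (s - 1) - 1 \<and> odd k. \<Sum>i<m. a (i * 2 ^ s + k)) = 1
    \<and> gcd (\<Sum>k<m. monom (\<Sum>i<2 ^ s. a (i * m + k)) k) (monom 1 m - 1 :: bit poly) = 1"
proof -
  have "s \<noteq> 0" "s \<noteq> 1"
    using assms(2) by (auto intro: ccontr)
  then obtain t where t: "s = t + 2"
    by (metis One_nat_def Suc_1 add_2_eq_Suc' not0_implies_Suc)
  \<comment> \<open>A quarter of \<open>2 ^ s\<close>, so that \<open>n\<close> is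
    \<open>4 * d * m\<close> and its half is \<open>2 * d * m\<close>.\<close>
  define d :: nat where "d = 2 ^ t"
  have d: "d > 0" "2 ^ s = 4 * d" "2 ^ (s - 1) = 2 * d"
    by (simp_all add: d_def t)
  have "m > 0"
    using \<open>odd m\<close> by (rule odd_pos)
  have n: "n = 4 * d * m"
    by (simp add: assms(1) d)
  then have "n > 0"
    using d \<open>m > 0\<close> by simp
  have "(\<Sum>i<m. a (i * 2 ^ s)) = 1"
    using symmetric_vector_sum_residue_0[of "4 * d" m a] assms(3,5) d n
      corresponding_vector_0(1)[OF assms(4) \<open>n > 0\<close> assms(6,7)] by simp
  moreover have "(\<Sum>i<m. a (i * 2 ^ s + 2 ^ (s - 1))) = 0"
    using symmetric_vector_sum_residue_half[of "2 * d" m a] assms(3,4,5,7) d n \<open>m > 0\<close>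
      corresponding_vector_half[of "2 * d * m" \<alpha> a] by (simp add: mult.assoc)
  moreover have "(\<Sum>k | 1 \<le> k \<and> k \<le> 2 ^ (s - 1) - 1 \<and> odd k. \<Sum>i<m. a (i * 2 ^ s + k)) = 1"
    using symmetric_vector_sum_odd_residues[of d m a] assms(4-7) d n \<open>m > 0\<close>
      corresponding_vector_sum_1_mod_4[of "d * m" \<alpha> a] by (simp add: mult.assoc)
  moreover have "coprime (\<Sum>k<m. monom (\<Sum>i<2 ^ s. a (i * m + k)) k) (monom 1 m - 1)"
    using coprime_corresponding_vector[OF assms(4) \<open>n > 0\<close> assms(6,7)]
    by (intro coprime_fold_monom) (simp add: assms(1))
  ultimately show ?thesis
    by (simp add: coprime_iff_gcd_eq_1)
qed

end
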